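(* Let $\Gamma$ be a unimodular Gaussian lattice of rank $2g$ over $\mathbb{Z}$, and let $q:A_2\to\mathbb{Z}/4$ be an $i$-invariant quadratic form associated to $e$. The formulas $$b(\varepsilon\alpha,\varepsilon\beta)=e(\alpha,\varepsilon\beta),\qquad Q_q(\varepsilon\alpha)=q(\alpha)-Q(\alpha)\qquad\text{for }\alpha,\beta\in A_2,$$ define on $A_i=\varepsilon A_2$ a non-degenerate symmetric (bilinear) form $b$ and a quadratic form $Q_q:A_i\to\mathbb{Z}/4$ associated with $b$.
   Context: A Gaussian lattice is a free finitely generated $\mathbb{Z}[i]$-module $\Gamma$ with a positive (definite) hermitian form $H:\Gamma\times\Gamma\to\mathbb{Z}[i]$, $\mathbb{C}$-linear in the second variable. Write $H=S+iE$ with $S,E$ $\mathbb{Z}$-valued; $S$ is symmetric, $E$ is skew-symmetric, $S$ and $E$ are invariant under multiplication by $i$, and $E(x,y)=S(ix,y)$. $\Gamma$ is unimodular if $\det S=\det E=(\det H)^2=1$. Let $A_2=\Gamma/2\Gamma$, a free module of rank $g$ over $\mathbb{F}_2[i]=\mathbb{F}_2[\varepsilon]$, where $\varepsilon=1+i$ and $\varepsilon^2=0$. The subgroup of $i$-invariant elements of $A_2$ is $A_i=\operatorname{Ker}\varepsilon=\varepsilon A_2$, an $\mathbb{F}_2$-vector space of dimension $g$. (With $A_\Gamma=(\Gamma\otimes_{\mathbb{Z}}\mathbb{R})/\Gamma$, $A_2$ is identified with the 2-torsion subgroup of $A_\Gamma$ and $A_i$ with the group of $i$-invariant points of $A_\Gamma$.)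 Let $e:A_2\times A_2\to\mathbb{F}_2$ be the symplectic form induced by $E$, and $Q:A_2\to\mathbb{Z}/4$ the map induced by $x\mapsto S(x,x)$. For a non-degenerate symmetric bilinear form $b$ on a finite-dimensional $\mathbb{F}_2$-vector space $V$, a quadratic form associated to $b$ is a function $q:V\to\mathbb{Z}/4$ with $q(x+y)=q(x)+q(y)+2b(x,y)$ for $x,y\in V$, where multiplication by 2 stands for the isomorphism $\mathbb{Z}/2\cong2\mathbb{Z}/4\mathbb{Z}\subset\mathbb{Z}/4$. A form $q$ on $A_2$ is $i$-invariant if $q(i\alpha)=q(\alpha)$ for all $\alpha\in A_2$. *)

theory Defs
  imports
    Complex_Main
    "HOL-Library.Z2"
    "HOL-Library.Numeral_Type"
    "Jordan_Normal_Form.Determinant"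
begin

section \<open>Gaussian integers\<close>

datatype gauss_int = Gauss_Int (gRe: int) (gIm: int)

instantiation gauss_int :: comm_ring_1
begin

definition "0 = Gauss_Int 0 0"
definition "1 = Gauss_Int 1 0"
definition "x + y = Gauss_Int (gRe x + gRe y) (gIm x + gIm y)" for x y :: gauss_int
definition "- x = Gauss_Int (- gRe x) (- gIm x)" for x :: gauss_int
definition "x - y = Gauss_Int (gRe x - gRe y) (gIm x - gIm y)" for x y :: gauss_int
definition "x * y = Gauss_Int (gRe x * gRe y - gIm x * gIm y) (gRe x * gIm y + gIm x * gRe y)"
  for x y :: gauss_int

instance
  by standard
    (simp_all add: zero_gauss_int_def one_gauss_int_def plus_gauss_int_def uminus_gauss_int_def
      minus_gauss_int_def times_gauss_int_def algebra_simps gauss_int.expand)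

end

lemmas gauss_int_defs = zero_gauss_int_def one_gauss_int_def plus_gauss_int_def
  uminus_gauss_int_def minus_gauss_int_def times_gauss_int_def

definition gcnj :: "gauss_int \<Rightarrow> gauss_int" where
  "gcnj z = Gauss_Int (gRe z) (- gIm z)"

definition g_i :: gauss_int where
  "g_i = Gauss_Int 0 1"

definition g_eps :: gauss_int where
  "g_eps = 1 + g_i"

lemma g_i_squared: "g_i * g_i = - 1"
  by (simp add: g_i_def gauss_int_defs)


section \<open>Gaussian lattices\<close>

text \<open>The locale of modules is written \<open>Modules.module\<close> throughout because HOL-Algebra has
  another locale of the same name.\<close>

definition is_basis :: "('r::comm_ring_1 \<Rightarrow> 'a::ab_group_add \<Rightarrow> 'a) \<Rightarrow> 'a list \<Rightarrow> bool" where
  "is_basis s vs \<longleftrightarrow>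
     distinct vs \<and> \<not> Modules.module.dependent s (set vs) \<and> Modules.module.span s (set vs) = UNIV"

locale gaussian_lattice = Modules.module scale
  for scale :: "gauss_int \<Rightarrow> 'a::ab_group_add \<Rightarrow> 'a" +
  fixes H :: "'a \<Rightarrow> 'a \<Rightarrow> gauss_int"
  assumes free: "\<exists>vs. is_basis scale vs"
    and H_add_right: "H x (y + z) = H x y + H x z"
    and H_scale_right: "H x (scale c y) = c * H x y"
    and H_hermitian: "H y x = gcnj (H x y)"
    and H_pos: "x \<noteq> 0 \<Longrightarrow> gRe (H x x) > 0"

definition S_form :: "('a \<Rightarrow> 'a \<Rightarrow> gauss_int) \<Rightarrow> 'a \<Rightarrow> 'a \<Rightarrow> int" where
  "S_form H x y = gRe (H x y)"

definition E_form :: "('a \<Rightarrow> 'a \<Rightarrow> gauss_int) \<Rightarrow> 'a \<Rightarrow> 'a \<Rightarrow> int" where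
  "E_form H x y = gIm (H x y)"

definition int_scale :: "(gauss_int \<Rightarrow> 'a \<Rightarrow> 'a) \<Rightarrow> int \<Rightarrow> 'a \<Rightarrow> 'a" where
  "int_scale s n = s (of_int n)"

definition has_int_rank :: "(gauss_int \<Rightarrow> 'a::ab_group_add \<Rightarrow> 'a) \<Rightarrow> nat \<Rightarrow> bool" where
  "has_int_rank s n \<longleftrightarrow> (\<exists>vs. is_basis (int_scale s) vs \<and> length vs = n)"

definition gram :: "('a \<Rightarrow> 'a \<Rightarrow> 'r) \<Rightarrow> 'a list \<Rightarrow> 'r mat" where
  "gram h vs = mat (length vs) (length vs) (\<lambda>(j, k). h (vs ! j) (vs ! k))"

text \<open>The determinants of \<open>S\<close> and \<open>E\<close> are taken in a basis over the integers, that of \<open>H\<close> in a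
  basis over the Gaussian integers.  A change of basis multiplies them by the square of \<open>\<plusminus>1\<close>,
  respectively by the norm of a unit, so none of them depends on the basis.\<close>

definition unimodular :: "(gauss_int \<Rightarrow> 'a::ab_group_add \<Rightarrow> 'a) \<Rightarrow> ('a \<Rightarrow> 'a \<Rightarrow> gauss_int) \<Rightarrow> bool" where
  "unimodular s H \<longleftrightarrow>
     (\<exists>vs. is_basis (int_scale s) vs \<and> det (gram (S_form H) vs) = 1 \<and> det (gram (E_form H) vs) = 1) \<and>
     (\<exists>ws. is_basis s ws \<and> (det (gram H ws))\<^sup>2 = 1)"

context gaussian_lattice
begin

lemma H_add_left: "H (x + y) z = H x z + H y z"
  by (subst (1 2 3) H_hermitian) (simp add: H_add_right gcnj_def gauss_int_defs)

lemma S_sym: "S_form H x y = S_form H y x"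
  unfolding S_form_def by (subst H_hermitian) (simp add: gcnj_def)

lemma E_skew: "E_form H x y = - E_form H y x"
  unfolding E_form_def by (subst H_hermitian) (simp add: gcnj_def)

lemma S_add_right: "S_form H x (y + z) = S_form H x y + S_form H x z"
  by (simp add: S_form_def H_add_right gauss_int_defs)

lemma S_add_left: "S_form H (x + y) z = S_form H x z + S_form H y z"
  by (simp add: S_form_def H_add_left gauss_int_defs)

lemma E_add_right: "E_form H x (y + z) = E_form H x y + E_form H x z"
  by (simp add: E_form_def H_add_right gauss_int_defs)

lemma E_add_left: "E_form H (x + y) z = E_form H x z + E_form H y z"
  by (simp add: E_form_def H_add_left gauss_int_defs)

lemma E_eq_S: "E_form H x y = S_form H (scale g_i x) y"
  by (subst S_sym, subst E_skew)
    (simp add: E_form_def S_form_def H_scale_right g_i_def gauss_int_defs)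

end


section \<open>The quotient by twice the lattice\<close>

definition cong_mod2 :: "'a::ab_group_add \<Rightarrow> 'a \<Rightarrow> bool" where
  "cong_mod2 x y \<longleftrightarrow> (\<exists>z. x - y = z + z)"

lemma equivp_cong_mod2: "equivp (cong_mod2 :: 'a::ab_group_add \<Rightarrow> 'a \<Rightarrow> bool)"
proof (rule equivpI)
  show "reflp (cong_mod2 :: 'a \<Rightarrow> 'a \<Rightarrow> bool)"
    by (rule reflpI) (simp add: cong_mod2_def exI[of _ 0])
  show "symp (cong_mod2 :: 'a \<Rightarrow> 'a \<Rightarrow> bool)"
    by (rule sympI) (metis cong_mod2_def minus_add_distrib minus_diff_eq add.commute)
  show "transp (cong_mod2 :: 'a \<Rightarrow> 'a \<Rightarrow> bool)"
  proof (rule transpI)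
    fix x y z :: 'a
    assume "cong_mod2 x y" "cong_mod2 y z"
    then obtain u v where "x - y = u + u" "y - z = v + v"
      by (auto simp: cong_mod2_def)
    then have "x - z = (u + v) + (u + v)"
      by (simp add: algebra_simps)
    then show "cong_mod2 x z"
      by (auto simp: cong_mod2_def)
  qed
qed

quotient_type (overloaded) 'a mod2 = "'a::ab_group_add" / "cong_mod2"
  by (rule equivp_cong_mod2)

instantiation mod2 :: (ab_group_add) ab_group_add
begin

lift_definition zero_mod2 :: "'a mod2" is 0 .

lift_definition plus_mod2 :: "'a mod2 \<Rightarrow> 'a mod2 \<Rightarrow> 'a mod2" is "(+)"
proof -
  fix x x' y y' :: 'a
  assume "cong_mod2 x x'" "cong_mod2 y y'"
  then obtain u v where "x - x' = u + u" "y - y' = v + v"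
    by (auto simp: cong_mod2_def)
  then have "(x + y) - (x' + y') = (u + v) + (u + v)"
    by (simp add: algebra_simps)
  then show "cong_mod2 (x + y) (x' + y')"
    by (auto simp: cong_mod2_def)
qed

lift_definition uminus_mod2 :: "'a mod2 \<Rightarrow> 'a mod2" is uminus
proof -
  fix x x' :: 'a
  assume "cong_mod2 x x'"
  then obtain u where "x - x' = u + u"
    by (auto simp: cong_mod2_def)
  then have "- x - (- x') = (- u) + (- u)"
    by (simp add: algebra_simps)
  then show "cong_mod2 (- x) (- x')"
    unfolding cong_mod2_def by blast
qed

definition minus_mod2 :: "'a mod2 \<Rightarrow> 'a mod2 \<Rightarrow> 'a mod2" where
  "minus_mod2 x y = x + (- y)"

instance
proof
  fix a b c :: "'a mod2"
  have refl: "cong_mod2 x x" for x :: 'a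
    by (rule equivp_reflp[OF equivp_cong_mod2])
  show "a + b + c = a + (b + c)"
    by transfer (simp add: add.assoc refl)
  show "a + b = b + a"
    by transfer (simp add: add.commute refl)
  show "0 + a = a"
    by transfer (simp add: refl)
  show "- a + a = 0"
    by transfer (simp add: refl)
  show "a - b = a + - b"
    by (rule minus_mod2_def)
qed

end

lemma abs_mod2_add: "abs_mod2 x + abs_mod2 y = abs_mod2 (x + y)"
  by (rule plus_mod2.abs_eq)

lemma abs_mod2_eq_iff: "abs_mod2 x = abs_mod2 y \<longleftrightarrow> (\<exists>z. x - y = z + z)"
  by (simp add: mod2.abs_eq_iff cong_mod2_def)

lemma mod2_add_self: "(\<alpha> :: 'a::ab_group_add mod2) + \<alpha> = 0"
proof (induct \<alpha>)
  case (1 x)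
  have "abs_mod2 (x + x) = abs_mod2 0"
    by (auto simp: abs_mod2_eq_iff)
  then show ?case
    by (simp add: abs_mod2_add zero_mod2_def)
qed

definition f2_scale :: "bit \<Rightarrow> 'a::ab_group_add mod2 \<Rightarrow> 'a mod2" where
  "f2_scale c \<alpha> = (if c = 0 then 0 else \<alpha>)"

lemma vector_space_f2_scale: "vector_space f2_scale"
  by standard (auto simp: f2_scale_def mod2_add_self)

text \<open>The following maps on the quotient are defined on representatives; the lemmas
  \<open>mod2_scale_abs\<close>, \<open>e_form_abs\<close> and \<open>Q_form_abs\<close> below give their values on all classes and
  so show that they do not depend on the representatives.\<close>

definition mod2_scale :: "(gauss_int \<Rightarrow> 'a \<Rightarrow> 'a) \<Rightarrow> gauss_int \<Rightarrow> 'a::ab_group_add mod2 \<Rightarrow> 'a mod2" where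
  "mod2_scale s c \<alpha> = abs_mod2 (s c (rep_mod2 \<alpha>))"

definition e_form :: "('a \<Rightarrow> 'a \<Rightarrow> gauss_int) \<Rightarrow> 'a::ab_group_add mod2 \<Rightarrow> 'a mod2 \<Rightarrow> bit" where
  "e_form H \<alpha> \<beta> = of_int (E_form H (rep_mod2 \<alpha>) (rep_mod2 \<beta>))"

definition Q_form :: "('a \<Rightarrow> 'a \<Rightarrow> gauss_int) \<Rightarrow> 'a::ab_group_add mod2 \<Rightarrow> 4" where
  "Q_form H \<alpha> = of_int (S_form H (rep_mod2 \<alpha>) (rep_mod2 \<alpha>))"

definition i_invariants :: "(gauss_int \<Rightarrow> 'a \<Rightarrow> 'a) \<Rightarrow> 'a::ab_group_add mod2 set" where
  "i_invariants s = {\<alpha>. mod2_scale s g_i \<alpha> = \<alpha>}"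

lemma four_eq_0: "(4 :: 4) = 0"
  by simp

lemma rep_abs_mod2E:
  obtains z where "rep_mod2 (abs_mod2 x) = x + (z + z)"
proof -
  have "cong_mod2 (rep_mod2 (abs_mod2 x)) x"
    using Quotient_rep_abs[OF Quotient_mod2, of x] equivp_reflp[OF equivp_cong_mod2] by blast
  then show thesis
    using that unfolding cong_mod2_def by (metis add.commute diff_add_cancel)
qed

context gaussian_lattice
begin

lemma mod2_scale_abs: "mod2_scale scale c (abs_mod2 x) = abs_mod2 (scale c x)"
proof -
  obtain z where z: "rep_mod2 (abs_mod2 x) = x + (z + z)"
    by (rule rep_abs_mod2E)
  have "scale c (x + (z + z)) - scale c x = scale c z + scale c z"
    by (simp add: scale_right_distrib)
  then show ?thesis
    unfolding mod2_scale_def z abs_mod2_eq_iff by blast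
qed

lemma e_form_abs: "e_form H (abs_mod2 x) (abs_mod2 y) = of_int (E_form H x y)"
proof -
  obtain z w where z: "rep_mod2 (abs_mod2 x) = x + (z + z)" and w: "rep_mod2 (abs_mod2 y) = y + (w + w)"
    by (meson rep_abs_mod2E)
  show ?thesis
    unfolding e_form_def z w by (simp add: E_add_left E_add_right)
qed

lemma Q_form_abs: "Q_form H (abs_mod2 x) = of_int (S_form H x x)"
proof -
  obtain z where z: "rep_mod2 (abs_mod2 x) = x + (z + z)"
    by (rule rep_abs_mod2E)
  have "S_form H (x + (z + z)) (x + (z + z)) = S_form H x x + 4 * (S_form H x z + S_form H z z)"
    by (simp add: S_add_left S_add_right S_sym[of z x])
  then show ?thesis
    unfolding Q_form_def z by (simp del: distrib_left_numeral add: four_eq_0)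
qed

end


section \<open>Forms on vector spaces over the field with two elements\<close>

text \<open>The vector space is a subset \<open>V\<close> of an ambient space \<open>'v\<close> with scalar multiplication \<open>s\<close>;
  values of the forms outside \<open>V\<close> are irrelevant.\<close>

definition finite_dim_subspace :: "(bit \<Rightarrow> 'v::ab_group_add \<Rightarrow> 'v) \<Rightarrow> 'v set \<Rightarrow> bool" where
  "finite_dim_subspace s V \<longleftrightarrow>
     Modules.module.subspace s V \<and> (\<exists>B. finite B \<and> Modules.module.span s B = V)"

definition symmetric_bilinear_on ::
  "(bit \<Rightarrow> 'v::ab_group_add \<Rightarrow> 'v) \<Rightarrow> 'v set \<Rightarrow> ('v \<Rightarrow> 'v \<Rightarrow> bit) \<Rightarrow> bool" where
  "symmetric_bilinear_on s V b \<longleftrightarrow>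
     (\<forall>x\<in>V. \<forall>y\<in>V. b x y = b y x) \<and>
     (\<forall>x\<in>V. \<forall>y\<in>V. \<forall>z\<in>V. b (x + y) z = b x z + b y z) \<and>
     (\<forall>c. \<forall>x\<in>V. \<forall>y\<in>V. b (s c x) y = c * b x y)"

definition nondegenerate_on :: "'v::zero set \<Rightarrow> ('v \<Rightarrow> 'v \<Rightarrow> bit) \<Rightarrow> bool" where
  "nondegenerate_on V b \<longleftrightarrow> (\<forall>x\<in>V. (\<forall>y\<in>V. b x y = 0) \<longrightarrow> x = 0)"

definition times2 :: "bit \<Rightarrow> 4" where
  "times2 c = (if c = 0 then 0 else 2)"

definition quadratic_form_on :: "'v::plus set \<Rightarrow> ('v \<Rightarrow> 'v \<Rightarrow> bit) \<Rightarrow> ('v \<Rightarrow> 4) \<Rightarrow> bool" where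
  "quadratic_form_on V b q \<longleftrightarrow> (\<forall>x\<in>V. \<forall>y\<in>V. q (x + y) = q x + q y + times2 (b x y))"

end

theory Submission
  imports Defs
begin

text \<open>Multiplication by \<open>\<epsilon> = 1 + i\<close> squares to zero on the quotient \<open>A\<^sub>2\<close> of the lattice by its double,
  and because the lattice has no torsion and \<open>2\<close> is the product of \<open>\<epsilon>\<close> with its conjugate, the
  kernel of \<open>\<epsilon>\<close> is no larger than its image.  Modulo two, \<open>\<epsilon>\<close> equals its conjugate, so it is
  self-adjoint for \<open>e\<close>.  Hence \<open>e(\<alpha>, \<epsilon>\<beta>) = e(\<epsilon>\<alpha>, \<beta>)\<close> depends only on \<open>\<epsilon>\<alpha>\<close> and
  \<open>\<epsilon>\<beta>\<close>, is symmetric in them, and is non-degenerate because \<open>e\<close> is.  The non-degeneracy of \<open>e\<close> is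
  where unimodularity enters: a linear system with unimodular integer matrix whose right-hand side
  is even has an even solution (\<open>e_nondegenerate\<close>).

  For \<open>Q\<^sub>q\<close> the decisive identity is \<open>E(x, \<epsilon>y) = E(x, y) + S(x, y)\<close>.  The failures of additivity
  of \<open>q\<close> and of \<open>Q\<close> are \<open>2e\<close> and \<open>2S\<close>; modulo four their difference is therefore
  \<open>2e(\<alpha>, \<epsilon>\<beta>)\<close>, which is twice the form to be associated with \<open>Q\<^sub>q\<close>
  (\<open>q_minus_Q_add\<close>).  It vanishes when \<open>\<beta>\<close> is itself a multiple of \<open>\<epsilon>\<close>, so \<open>q - Q\<close> descends to
  \<open>\<epsilon>A\<^sub>2\<close> as soon as it is zero on \<open>\<epsilon>A\<^sub>2\<close>.  That is the point at which the invariance of \<open>q\<close>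
  under \<open>i\<close> is needed (\<open>q_minus_Q_eps\<close>).\<close>

section \<open>Reduction of integers modulo two and four\<close>

lemma of_int_bit_eq_0_iff: "(of_int n :: bit) = 0 \<longleftrightarrow> even n"
proof (cases "even n")
  case True
  then obtain m where "n = 2 * m" by blast
  then show ?thesis by simp
next
  case False
  then obtain m where "n = 2 * m + 1" by (rule oddE)
  then show ?thesis by simp
qed

lemma of_int_bit_eq_iff: "(of_int m :: bit) = of_int n \<longleftrightarrow> even (m - n)"
proof -
  have "(of_int m :: bit) = of_int n \<longleftrightarrow> (of_int (m - n) :: bit) = 0"
    by (simp only: of_int_diff right_minus_eq)
  then show ?thesis by (simp only: of_int_bit_eq_0_iff)
qed

lemma times2_0: "times2 0 = 0"
  by (simp add: times2_def)

lemma times2_of_int: "times2 (of_int n) = of_int (2 * n)"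
proof (cases "even n")
  case True
  then obtain m where "n = 2 * m" by blast
  then have "(of_int (2 * n) :: 4) = 4 * of_int m" by simp
  then show ?thesis
    using True by (simp only: times2_def of_int_bit_eq_0_iff four_eq_0 if_True mult_zero_left)
next
  case False
  then obtain m where "n = 2 * m + 1" by (rule oddE)
  then have "(of_int (2 * n) :: 4) = 4 * of_int m + 2" by simp
  then show ?thesis
    using False by (simp only: times2_def of_int_bit_eq_0_iff four_eq_0 if_False mult_zero_left add_0)
qed

lemma mod2_abs_cases:
  obtains x where "\<alpha> = abs_mod2 x"
proof -
  have "\<exists>x. \<alpha> = abs_mod2 x" by (induct \<alpha>) blast
  then show thesis using that by blast
qed

section \<open>Linear systems with unimodular matrix\<close>

text \<open>The adjugate of a unimodular integer matrix is an integral inverse, so it recovers the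
  coefficients from the even numbers \<open>c G\<close> by an integer combination.\<close>

lemma unimodular_system_even:
  fixes G :: "int mat"
  assumes G: "G \<in> carrier_mat n n" and det: "det G = 1"
    and even: "\<And>k. k < n \<Longrightarrow> even (\<Sum>j<n. c j * G $$ (j, k))"
    and j: "j < n"
  shows "even (c j)"
proof -
  let ?A = "adj_mat G"
  have A: "?A \<in> carrier_mat n n" and GA: "G * ?A = 1\<^sub>m n"
    using adj_mat[OF G] det by auto
  have entry: "(\<Sum>k<n. G $$ (l, k) * ?A $$ (k, j)) = (if l = j then 1 else 0)" if "l < n" for l
  proof -
    have "(G * ?A) $$ (l, j) = (\<Sum>k<n. G $$ (l, k) * ?A $$ (k, j))"
      using that j G A by (simp add: scalar_prod_def atLeast0LessThan)
    then show ?thesis using that j by (simp add: GA)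
  qed
  have "(\<Sum>k<n. (\<Sum>l<n. c l * G $$ (l, k)) * ?A $$ (k, j)) =
      (\<Sum>l<n. c l * (\<Sum>k<n. G $$ (l, k) * ?A $$ (k, j)))"
    by (simp add: sum_distrib_left sum_distrib_right mult.assoc) (rule sum.swap)
  also have "\<dots> = (\<Sum>l<n. if l = j then c l else 0)"
    by (rule sum.cong) (simp_all add: entry)
  also have "\<dots> = c j"
    using j by simp
  finally show ?thesis
    by (metis (no_types, lifting) dvd_mult2 dvd_sum even lessThan_iff)
qed

section \<open>Multiplication by \<open>1 + i\<close> on the lattice and on its quotient\<close>

context gaussian_lattice
begin

abbreviation eps :: "'a mod2 \<Rightarrow> 'a mod2" where
  "eps \<equiv> mod2_scale scale g_eps"

lemma H_scale_left: "H (scale c x) y = gcnj c * H x y"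
  by (subst (1 2) H_hermitian) (simp add: H_scale_right gcnj_def gauss_int_defs algebra_simps)

lemma E_self: "E_form H x x = 0"
  using E_skew[of x x] by simp

lemma E_i_right: "E_form H x (scale g_i y) = S_form H x y"
  by (simp add: E_form_def S_form_def H_scale_right g_i_def gauss_int_defs)

lemma E_eps_right: "E_form H x (scale g_eps y) = E_form H x y + S_form H x y"
  by (simp add: E_form_def S_form_def H_scale_right g_eps_def g_i_def gauss_int_defs)

lemma E_eps_left: "E_form H (scale g_eps x) y = E_form H x y - S_form H x y"
  by (simp add: E_form_def S_form_def H_scale_left gcnj_def g_eps_def g_i_def gauss_int_defs)

lemma S_eps_eps: "S_form H (scale g_eps x) (scale g_eps y) = 2 * S_form H x y"
  by (simp add: S_form_def H_scale_right H_scale_left gcnj_def g_eps_def g_i_def gauss_int_defs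
      algebra_simps)

text \<open>If \<open>2z = 0\<close> then \<open>2 S(z, z) = S(z, 2z) = 0\<close>, which positivity excludes for \<open>z \<noteq> 0\<close>.\<close>

lemma torsion_free:
  fixes z :: 'a
  assumes "z + z = 0" shows "z = 0"
proof (rule ccontr)
  assume "z \<noteq> 0"
  then have "S_form H z z > 0" by (simp add: S_form_def H_pos)
  moreover have "S_form H z (z + z) = 0 + S_form H z 0"
    by (simp add: assms)
  moreover have "S_form H z 0 = 0"
    using S_add_right[of z 0 0] by simp
  ultimately show False by (simp add: S_add_right)
qed

lemma mod2_scale_add: "mod2_scale scale c (\<alpha> + \<beta>) = mod2_scale scale c \<alpha> + mod2_scale scale c \<beta>"
  by (cases \<alpha> rule: mod2_abs_cases, cases \<beta> rule: mod2_abs_cases)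
    (simp add: abs_mod2_add mod2_scale_abs scale_right_distrib)

lemma eps_eq: "eps \<alpha> = \<alpha> + mod2_scale scale g_i \<alpha>"
  by (cases \<alpha> rule: mod2_abs_cases)
    (simp add: g_eps_def mod2_scale_abs scale_left_distrib abs_mod2_add)

lemma mod2_add_eq_0_iff: "\<alpha> + \<beta> = 0 \<longleftrightarrow> \<alpha> = (\<beta> :: 'a mod2)"
  by (metis add_right_cancel mod2_add_self)

text \<open>In characteristic two, being fixed by \<open>i\<close> is the same as being killed by \<open>1 + i\<close>.\<close>

lemma i_invariants_eq_kernel: "i_invariants scale = {\<alpha>. eps \<alpha> = 0}"
  by (auto simp: i_invariants_def eps_eq mod2_add_eq_0_iff)

lemma eps_eps: "eps (eps \<alpha>) = 0"
proof (cases \<alpha> rule: mod2_abs_cases)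
  case (1 x)
  have "scale g_eps (scale g_eps x) - 0 = scale g_i x + scale g_i x"
    by (simp add: g_eps_def g_i_def gauss_int_defs flip: scale_left_distrib)
  then show ?thesis
    unfolding 1 mod2_scale_abs zero_mod2_def abs_mod2_eq_iff by blast
qed

text \<open>If \<open>\<epsilon>x = 2y\<close>, multiplying by the conjugate of \<open>\<epsilon>\<close> and cancelling the factor two shows that
  \<open>x\<close> is the conjugate of \<open>\<epsilon>\<close> times \<open>y\<close>, which is congruent to \<open>\<epsilon>y\<close> modulo two.\<close>

lemma kernel_eps_eq_range: "{\<alpha>. eps \<alpha> = 0} = range eps"
proof
  show "{\<alpha>. eps \<alpha> = 0} \<subseteq> range eps"
  proof safe
    fix \<alpha> assume eps0: "eps \<alpha> = 0"
    obtain x where x: "\<alpha> = abs_mod2 x" by (rule mod2_abs_cases)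
    obtain y where y: "scale g_eps x = y + y"
      using eps0 by (auto simp: x mod2_scale_abs zero_mod2_def abs_mod2_eq_iff)
    let ?w = "scale (gcnj g_eps) y"
    have "gcnj g_eps * g_eps = 1 + 1"
      by (simp add: gcnj_def g_eps_def g_i_def gauss_int_defs)
    then have "x + x = scale (gcnj g_eps) (scale g_eps x)"
      by (simp only: scale_scale scale_left_distrib scale_one)
    also have "\<dots> = ?w + ?w"
      by (simp only: y scale_right_distrib)
    finally have "(x - ?w) + (x - ?w) = 0"
      by (simp only: add_diff_add[symmetric] diff_self)
    then have "x - ?w = 0"
      by (rule torsion_free)
    then have "x = ?w"
      by (simp only: right_minus_eq)
    moreover have "gcnj g_eps - g_eps = - g_i + - g_i"
      by (simp add: gcnj_def g_eps_def g_i_def gauss_int_defs)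
    ultimately have "x - scale g_eps y = scale (- g_i) y + scale (- g_i) y"
      by (metis scale_left_diff_distrib scale_left_distrib)
    then have "\<alpha> = eps (abs_mod2 y)"
      unfolding x mod2_scale_abs abs_mod2_eq_iff by blast
    then show "\<alpha> \<in> range eps" by blast
  qed
qed (auto simp: eps_eps)

lemma i_invariants_eq_range: "i_invariants scale = range eps"
  by (simp add: i_invariants_eq_kernel kernel_eps_eq_range)

section \<open>The symplectic form and the multiplication by \<open>1 + i\<close>\<close>

lemma e_sym: "e_form H \<alpha> \<beta> = e_form H \<beta> \<alpha>"
proof (cases \<alpha> rule: mod2_abs_cases)
  case x: (1 x)
  show ?thesis
  proof (cases \<beta> rule: mod2_abs_cases)
    case y: (1 y)
    have "even (E_form H x y - E_form H y x)"
      using E_skew[of x y] by presburger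
    then show ?thesis
      by (simp only: x y e_form_abs of_int_bit_eq_iff)
  qed
qed

lemma e_add_left: "e_form H (\<alpha> + \<beta>) \<gamma> = e_form H \<alpha> \<gamma> + e_form H \<beta> \<gamma>"
  by (cases \<alpha> rule: mod2_abs_cases, cases \<beta> rule: mod2_abs_cases, cases \<gamma> rule: mod2_abs_cases)
    (simp only: e_form_abs abs_mod2_add E_add_left of_int_add)

lemma e_self: "e_form H \<alpha> \<alpha> = 0"
  by (cases \<alpha> rule: mod2_abs_cases) (simp add: e_form_abs E_self)

text \<open>Moving \<open>\<epsilon>\<close> from one argument to the other turns \<open>E(x, y) - S(x, y)\<close> into
  \<open>E(x, y) + S(x, y)\<close>, and these two integers have the same parity.\<close>

lemma e_eps_adjoint: "e_form H (eps \<alpha>) \<beta> = e_form H \<alpha> (eps \<beta>)"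
  by (cases \<alpha> rule: mod2_abs_cases, cases \<beta> rule: mod2_abs_cases)
    (simp only: e_form_abs mod2_scale_abs of_int_bit_eq_iff E_eps_left E_eps_right, simp)

lemma e_zero_left: "e_form H 0 \<beta> = 0"
  using e_add_left[of 0 0 \<beta>] by simp

text \<open>By adjointness \<open>e(\<alpha>, \<epsilon>\<beta>) = e(\<epsilon>\<alpha>, \<beta>)\<close>, so that \<open>b(\<epsilon>\<alpha>, \<epsilon>\<beta>)\<close> may be defined as this value.\<close>

lemma e_eps_cong:
  assumes "eps \<alpha> = eps \<alpha>'"
  shows "e_form H \<alpha> (eps \<beta>) = e_form H \<alpha>' (eps \<beta>)"
  by (metis assms e_eps_adjoint)

section \<open>Coordinates over the integers: non-degeneracy and finiteness\<close>

lemma module_int_scale: "Modules.module (int_scale scale)"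
  by standard (simp_all add: int_scale_def scale_right_distrib scale_left_distrib)

lemma int_scale_double: "int_scale scale (2 * n) x = int_scale scale n x + int_scale scale n x"
  by (simp only: int_scale_def mult_2 of_int_add scale_left_distrib)

lemma E_int_scale_left: "E_form H (int_scale scale n x) y = n * E_form H x y"
proof -
  have "(of_int n :: gauss_int) = Gauss_Int n 0"
    by (induction n rule: int_induct[of _ 0]) (simp_all add: gauss_int_defs)
  then show ?thesis
    by (simp add: int_scale_def E_form_def H_scale_left gcnj_def gauss_int_defs)
qed

lemma int_basis_expansion:
  assumes "is_basis (int_scale scale) vs"
  obtains c where "x = (\<Sum>j<length vs. int_scale scale (c j) (vs ! j))"
proof -
  interpret Z: Modules.module "int_scale scale" by (rule module_int_scale)
  have "x \<in> Z.span (set vs)" and "distinct vs"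
    using assms by (simp_all add: is_basis_def)
  then obtain u where "x = (\<Sum>v\<in>set vs. int_scale scale (u v) v)"
    by (auto simp: Z.span_finite)
  also have "\<dots> = (\<Sum>j<length vs. int_scale scale (u (vs ! j)) (vs ! j))"
    by (rule sum.reindex_bij_betw[symmetric, OF bij_betw_nth]) (use \<open>distinct vs\<close> in auto)
  finally show thesis by (rule that)
qed

text \<open>If \<open>E(x, v)\<close> is even for every basis vector \<open>v\<close>, then the coordinates of \<open>x\<close>, multiplied by the
  Gram matrix of \<open>E\<close>, give even numbers; that matrix being unimodular, the coordinates
  are even and \<open>x\<close> is twice a lattice vector.\<close>

lemma e_nondegenerate:
  assumes "unimodular scale H" and e0: "\<And>\<beta>. e_form H \<alpha> \<beta> = 0"
  shows "\<alpha> = 0"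
proof -
  interpret Z: Modules.module "int_scale scale" by (rule module_int_scale)
  obtain vs where vs: "is_basis (int_scale scale) vs" and det: "det (gram (E_form H) vs) = 1"
    using assms(1) by (auto simp: unimodular_def)
  let ?n = "length vs"
  obtain x where x: "\<alpha> = abs_mod2 x" by (rule mod2_abs_cases)
  obtain c where c: "x = (\<Sum>j<?n. int_scale scale (c j) (vs ! j))"
    using vs by (rule int_basis_expansion)
  have E_sum: "E_form H (\<Sum>j\<in>J. f j) y = (\<Sum>j\<in>J. E_form H (f j) y)" if "finite J"
    for J :: "nat set" and f y
    using that
  proof (induction J)
    case empty show ?case using E_add_left[of 0 0 y] by simp
  qed (simp add: E_add_left)
  have "even (c j)" if "j < ?n" for j
  proof (rule unimodular_system_even[OF _ det _ that])
    show "gram (E_form H) vs \<in> carrier_mat ?n ?n" by (simp add: gram_def)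
    fix k assume k: "k < ?n"
    have "even (E_form H x (vs ! k))"
      using e0[of "abs_mod2 (vs ! k)"] by (simp add: x e_form_abs of_int_bit_eq_0_iff)
    also have "E_form H x (vs ! k) = (\<Sum>j<?n. c j * gram (E_form H) vs $$ (j, k))"
      by (simp add: c E_sum E_int_scale_left gram_def k)
    finally show "even (\<Sum>j<?n. c j * gram (E_form H) vs $$ (j, k))" .
  qed
  then have "x = (\<Sum>j<?n. int_scale scale (2 * (c j div 2)) (vs ! j))"
    unfolding c by (intro sum.cong) auto
  then have "x - 0 = (\<Sum>j<?n. int_scale scale (c j div 2) (vs ! j)) +
      (\<Sum>j<?n. int_scale scale (c j div 2) (vs ! j))"
    by (simp only: int_scale_double sum.distrib diff_zero)
  then show ?thesis
    unfolding x zero_mod2_def abs_mod2_eq_iff by blast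
qed

text \<open>Every class is represented by the sum of those basis vectors at which its coordinates are odd.\<close>

lemma finite_mod2:
  assumes vs: "is_basis (int_scale scale) vs"
  shows "finite (UNIV :: 'a mod2 set)"
proof -
  interpret Z: Modules.module "int_scale scale" by (rule module_int_scale)
  let ?n = "length vs"
  have "\<alpha> \<in> (\<lambda>J. abs_mod2 (\<Sum>j\<in>J. vs ! j)) ` Pow {..<?n}" for \<alpha> :: "'a mod2"
  proof -
    obtain x where x: "\<alpha> = abs_mod2 x" by (rule mod2_abs_cases)
    obtain c where c: "x = (\<Sum>j<?n. int_scale scale (c j) (vs ! j))"
      using vs by (rule int_basis_expansion)
    let ?J = "{j \<in> {..<?n}. odd (c j)}"
    let ?h = "\<Sum>j<?n. int_scale scale (c j div 2) (vs ! j)"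
    have parts: "int_scale scale (c j) v = int_scale scale (c j div 2) v + int_scale scale (c j div 2) v
        + (if odd (c j) then v else 0)" for j v
    proof (cases "even (c j)")
      case True
      then obtain m where "c j = 2 * m" by (rule evenE)
      then show ?thesis by (simp add: int_scale_double)
    next
      case False
      then obtain m where "c j = 2 * m + 1" by (rule oddE)
      then show ?thesis by (simp add: Z.scale_left_distrib int_scale_double)
    qed
    have "(\<Sum>j\<in>?J. vs ! j) = (\<Sum>j<?n. if odd (c j) then vs ! j else 0)"
      by (rule sum.inter_filter) simp
    then have "x = ?h + ?h + (\<Sum>j\<in>?J. vs ! j)"
      by (simp only: c parts sum.distrib)
    then have "x - (\<Sum>j\<in>?J. vs ! j) = ?h + ?h" by simp
    then have "\<alpha> = abs_mod2 (\<Sum>j\<in>?J. vs ! j)"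
      unfolding x abs_mod2_eq_iff by blast
    then show ?thesis by blast
  qed
  then have "UNIV \<subseteq> (\<lambda>J. abs_mod2 (\<Sum>j\<in>J. vs ! j)) ` Pow {..<?n}" by blast
  then show ?thesis by (rule finite_subset) simp
qed

lemma finite_dim_i_invariants:
  assumes "unimodular scale H"
  shows "finite_dim_subspace f2_scale (i_invariants scale)"
proof -
  interpret F: vector_space "f2_scale :: bit \<Rightarrow> 'a mod2 \<Rightarrow> 'a mod2"
    by (rule vector_space_f2_scale)
  have "eps 0 = 0" by (metis eps_eps mod2_add_self mod2_scale_add)
  then have sub: "F.subspace (i_invariants scale)"
    by (auto simp: F.subspace_def i_invariants_eq_kernel mod2_scale_add f2_scale_def)
  moreover have "finite (i_invariants scale)"
    using assms finite_mod2 finite_subset[OF subset_UNIV] by (auto simp: unimodular_def)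
  moreover have "F.span (i_invariants scale) = i_invariants scale"
    using sub by (simp add: F.span_eq_iff)
  ultimately show ?thesis
    unfolding finite_dim_subspace_def by blast
qed

section \<open>The difference of the two quadratic functions\<close>

context
  fixes q :: "'a mod2 \<Rightarrow> 4"
  assumes q_form: "quadratic_form_on UNIV (e_form H) q"
    and q_inv: "\<And>\<alpha>. q (mod2_scale scale g_i \<alpha>) = q \<alpha>"
begin

lemma q_add: "q (\<alpha> + \<beta>) = q \<alpha> + q \<beta> + times2 (e_form H \<alpha> \<beta>)"
  using q_form by (simp add: quadratic_form_on_def)

text \<open>The form \<open>e\<close> is alternating and \<open>2\<alpha> = 0\<close>; hence \<open>q\<close> takes only even values.\<close>

lemma q_double: "q \<alpha> + q \<alpha> = 0"
proof -
  have add_self: "q (\<gamma> + \<gamma>) = q \<gamma> + q \<gamma>" for \<gamma>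
    by (simp only: q_add e_self times2_0 add_0_right)
  have "q 0 = 0"
    using add_self[of 0] by (simp only: add_0_right add_cancel_right_right)
  then show ?thesis
    using add_self[of \<alpha>] by (simp only: mod2_add_self)
qed

text \<open>The correction terms of \<open>q\<close> and \<open>Q\<close> are \<open>2E(x, y)\<close> and \<open>2S(x, y)\<close>.  Modulo four, their difference
  is the same as their sum, which is \<open>2E(x, \<epsilon>y)\<close>.\<close>

lemma q_minus_Q_add:
  "q (\<alpha> + \<beta>) - Q_form H (\<alpha> + \<beta>) =
    (q \<alpha> - Q_form H \<alpha>) + (q \<beta> - Q_form H \<beta>) + times2 (e_form H \<alpha> (eps \<beta>))"
proof (cases \<alpha> rule: mod2_abs_cases)
  case x: (1 x)
  show ?thesis
  proof (cases \<beta> rule: mod2_abs_cases)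
    case y: (1 y)
    let ?E = "E_form H x y" and ?S = "S_form H x y"
    have "S_form H (x + y) (x + y) = S_form H x x + S_form H y y + 2 * ?S"
      by (simp add: S_add_left S_add_right S_sym[of y x])
    then have Q: "Q_form H (\<alpha> + \<beta>) = Q_form H \<alpha> + Q_form H \<beta> + of_int (2 * ?S)"
      by (simp only: x y abs_mod2_add Q_form_abs of_int_add)
    have "2 * (?E + ?S) - 4 * ?S + 2 * ?S = 2 * ?E"
      by simp
    then have "(of_int (2 * ?E) :: 4) = of_int (2 * (?E + ?S)) - of_int (4 * ?S) + of_int (2 * ?S)"
      by (simp only: flip: of_int_add of_int_diff)
    moreover have "(of_int (4 * ?S) :: 4) = 0"
      by (simp only: of_int_mult of_int_numeral four_eq_0 mult_zero_left)
    ultimately have e: "times2 (e_form H \<alpha> \<beta>) = times2 (e_form H \<alpha> (eps \<beta>)) + of_int (2 * ?S)"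
      by (simp only: x y e_form_abs mod2_scale_abs times2_of_int E_eps_right diff_zero)
    have rearrange: "a + b + (c + s) - (a' + b' + s) = (a - a') + (b - b') + c" for a b c s a' b' :: 4
      by (simp add: algebra_simps)
    show ?thesis
      by (simp only: q_add Q e rearrange)
  qed
qed

text \<open>Since \<open>q(\<alpha>) = q(i\<alpha>)\<close>, the value \<open>q(\<alpha> + i\<alpha>)\<close> is \<open>2q(\<alpha>) + 2e(\<alpha>, i\<alpha>)\<close>.  The first term is
  zero and the second is \<open>2S(x, x)\<close>, which is also the norm of \<open>\<epsilon>x\<close>.\<close>

lemma q_minus_Q_eps: "q (eps \<alpha>) - Q_form H (eps \<alpha>) = 0"
proof (cases \<alpha> rule: mod2_abs_cases)
  case (1 x)
  have "q (eps \<alpha>) = times2 (e_form H \<alpha> (mod2_scale scale g_i \<alpha>))"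
    by (simp only: eps_eq q_add q_inv q_double add_0)
  also have "\<dots> = of_int (2 * S_form H x x)"
    by (simp only: 1 mod2_scale_abs e_form_abs E_i_right times2_of_int)
  also have "\<dots> = Q_form H (eps \<alpha>)"
    by (simp only: 1 mod2_scale_abs Q_form_abs S_eps_eps)
  finally show ?thesis by (simp only: diff_self)
qed

text \<open>Two elements with the same image differ by an element of \<open>Ker \<epsilon> = \<epsilon>A\<^sub>2\<close>; adding \<open>\<epsilon>\<gamma>\<close> contributes
  neither a value of \<open>q - Q\<close> nor a correction term, the latter because \<open>\<epsilon>\<^sup>2 = 0\<close>.\<close>

lemma q_minus_Q_cong:
  assumes "eps \<alpha> = eps \<alpha>'"
  shows "q \<alpha> - Q_form H \<alpha> = q \<alpha>' - Q_form H \<alpha>'"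
proof -
  have "eps (\<alpha>' + \<alpha>) = 0"
    by (simp add: mod2_scale_add assms mod2_add_self)
  then obtain \<gamma> where \<gamma>: "\<alpha>' + \<alpha> = eps \<gamma>"
    using kernel_eps_eq_range by blast
  have "\<alpha> = \<alpha>' + eps \<gamma>"
    by (metis \<gamma> add.assoc add_0 mod2_add_self)
  then show ?thesis
    by (simp only: q_minus_Q_add q_minus_Q_eps eps_eps e_sym[of _ 0] e_zero_left times2_0
        add_0_right)
qed

end

end

theorem lemma1:
  fixes scale :: "gauss_int \<Rightarrow> 'a::ab_group_add \<Rightarrow> 'a"
    and H :: "'a \<Rightarrow> 'a \<Rightarrow> gauss_int"
    and g :: nat
    and q :: "'a mod2 \<Rightarrow> 4"
  assumes lattice: "gaussian_lattice scale H"
    and rank: "has_int_rank scale (2 * g)"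
    and unimod: "unimodular scale H"
    and q_form: "quadratic_form_on UNIV (e_form H) q"
    and q_inv: "\<forall>\<alpha>. q (mod2_scale scale g_i \<alpha>) = q \<alpha>"
  shows "i_invariants scale = range (mod2_scale scale g_eps) \<and>
    (\<exists>(b :: 'a mod2 \<Rightarrow> 'a mod2 \<Rightarrow> bit) (Qq :: 'a mod2 \<Rightarrow> 4).
      (\<forall>\<alpha> \<beta>. b (mod2_scale scale g_eps \<alpha>) (mod2_scale scale g_eps \<beta>) =
              e_form H \<alpha> (mod2_scale scale g_eps \<beta>)) \<and>
      (\<forall>\<alpha>. Qq (mod2_scale scale g_eps \<alpha>) = q \<alpha> - Q_form H \<alpha>) \<and>
      finite_dim_subspace f2_scale (i_invariants scale) \<and>
      symmetric_bilinear_on f2_scale (i_invariants scale) b \<and>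
      nondegenerate_on (i_invariants scale) b \<and>
      quadratic_form_on (i_invariants scale) b Qq)"
proof -
  interpret gaussian_lattice scale H by (rule lattice)
  note q_minus_Q = q_form q_inv[rule_format]
  (* Any preimage under eps serves; the congruence lemmas make the choice immaterial. *)
  define b where "b u v = e_form H (inv_into UNIV eps u) v" for u v
  define Qq where "Qq u = q (inv_into UNIV eps u) - Q_form H (inv_into UNIV eps u)" for u
  have eps_inv: "eps (inv_into UNIV eps (eps \<alpha>)) = eps \<alpha>" for \<alpha>
    by (rule f_inv_into_f) simp
  have b: "b (eps \<alpha>) (eps \<beta>) = e_form H \<alpha> (eps \<beta>)" for \<alpha> \<beta>
    unfolding b_def by (rule e_eps_cong[OF eps_inv])
  have Qq: "Qq (eps \<alpha>) = q \<alpha> - Q_form H \<alpha>" for \<alpha>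
    unfolding Qq_def by (rule q_minus_Q_cong[OF q_minus_Q eps_inv])
  have "b (eps \<alpha>) (eps \<beta>) = b (eps \<beta>) (eps \<alpha>)" for \<alpha> \<beta>
    by (metis b e_eps_adjoint e_sym)
  moreover have b_add: "b (eps \<alpha> + eps \<beta>) (eps \<gamma>) = b (eps \<alpha>) (eps \<gamma>) + b (eps \<beta>) (eps \<gamma>)"
    for \<alpha> \<beta> \<gamma>
    by (simp add: b e_add_left flip: mod2_scale_add)
  moreover have "b (f2_scale c (eps \<alpha>)) (eps \<beta>) = c * b (eps \<alpha>) (eps \<beta>)" for c \<alpha> \<beta>
    using b_add[of \<alpha> \<alpha> \<beta>] by (cases "c = 0") (auto simp: f2_scale_def mod2_add_self)
  ultimately have "symmetric_bilinear_on f2_scale (range eps) b"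
    by (auto simp: symmetric_bilinear_on_def)
  moreover have "nondegenerate_on (range eps) b"
    using e_nondegenerate[OF unimod] by (auto simp: nondegenerate_on_def b simp flip: e_eps_adjoint)
  moreover have "quadratic_form_on (range eps) b Qq"
  proof -
    have "Qq (eps \<alpha> + eps \<beta>) = Qq (eps \<alpha>) + Qq (eps \<beta>) + times2 (b (eps \<alpha>) (eps \<beta>))" for \<alpha> \<beta>
      using q_minus_Q_add[OF q_minus_Q] by (simp only: Qq b flip: mod2_scale_add)
    then show ?thesis by (auto simp: quadratic_form_on_def)
  qed
  ultimately show ?thesis
    using b Qq finite_dim_i_invariants[OF unimod] i_invariants_eq_range by auto
qed

end
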